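(* Let $G$ be a connected graph and let $H$ be a subgraph of $G$ that is a weak retract of $G$. If $\rho(H) > \rho$ for an integer $\rho \ge 0$, then $\rho(G) > \rho$.
   Context: Patrol game with radius of capture $\rho\ge 0$ on a connected graph $G$: there is one cop and one robber. Before the game the cop fixes a walk in $G$ (his patrol: a sequence of vertices in which consecutive vertices are equal or adjacent), and the robber knows the entire patrol in advance, while the cop has no information about the robber. The cop starts at the first vertex of his patrol, then the robber chooses a starting vertex; afterwards the players alternate moves (cop first), the cop following his patrol and the robber moving to an adjacent vertex or staying put. The cop wins (captures the robber) if at some moment the distance in $G$ between the cop and the robber is at most $\rho$; otherwise the robber wins. $\rho(G)$ denotes the minimum $\rho\ge 0$ such that the cop has a patrol that captures the robber regardless of how the robber plays. A weak homomorphism from $G$ to $H$ is a map $\varphi:V(G)\to V(H)$ such that adjacent vertices of $G$ are mapped to equal or adjacent vertices of $H$. A subgraph $H$ of $G$ is a weak retract of $G$ if there is a weak homomorphism $\varphi:V(G)\to V(H)$ with $\varphi(u)=u$ for all $u\in V(H)$. *)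

theory Defs
  imports
    "Graph_Theory.Digraph_Component"
    "Graph_Theory.Shortest_Path"
    "HOL-Library.Extended_Nat"
begin

text \<open>
  A (simple, undirected, possibly infinite) graph is a \<^typ>\<open>'a pair_pre_digraph\<close>
  satisfying \<^locale>\<open>pair_bidirected_digraph\<close>, that is, a symmetric loop-free
  adjacency relation on a set of vertices.  Distances take the value infinity between
  different components.
\<close>

definition graph_dist :: "'a pair_pre_digraph \<Rightarrow> 'a \<Rightarrow> 'a \<Rightarrow> ereal" where
  "graph_dist G u v = wf_digraph.\<mu> (with_proj G) (\<lambda>_. 1) u v"

definition lazy_walk :: "'a pair_pre_digraph \<Rightarrow> (nat \<Rightarrow> 'a) \<Rightarrow> bool" where
  "lazy_walk G w \<longleftrightarrow>
    (\<forall>i. w i \<in> pverts G) \<and> (\<forall>i. w (Suc i) = w i \<or> (w i, w (Suc i)) \<in> parcs G)"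

text \<open>
  Patrols and plays of the robber are infinite sequences; a finite patrol is represented
  by letting the cop stay at its last vertex forever.  Here \<open>c i\<close> and \<open>r i\<close> are the
  positions after round \<open>i\<close>, where round 0 is the initial placement.  In round \<open>i + 1\<close>
  the cop moves first, so the position \<open>(c (Suc i), r i)\<close> also occurs and is tested
  for capture.
\<close>

definition captures :: "'a pair_pre_digraph \<Rightarrow> nat \<Rightarrow> (nat \<Rightarrow> 'a) \<Rightarrow> (nat \<Rightarrow> 'a) \<Rightarrow> bool" where
  "captures G \<rho> c r \<longleftrightarrow>
    (\<exists>i. graph_dist G (c i) (r i) \<le> ereal (real \<rho>)
       \<or> graph_dist G (c (Suc i)) (r i) \<le> ereal (real \<rho>))"

text \<open>
  The cop does not react to the robber, and the robber knows the patrol in advance, so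
  the plays available to the robber are exactly the lazy walks, chosen after the patrol.
\<close>

definition winning_patrol :: "'a pair_pre_digraph \<Rightarrow> nat \<Rightarrow> (nat \<Rightarrow> 'a) \<Rightarrow> bool" where
  "winning_patrol G \<rho> c \<longleftrightarrow> lazy_walk G c \<and> (\<forall>r. lazy_walk G r \<longrightarrow> captures G \<rho> c r)"

text \<open>
  The minimum radius for which the cop has a winning patrol; it is \<open>\<infinity>\<close> if there is no
  such radius, which can only happen for infinite graphs among the connected ones.
\<close>

definition patrol_number :: "'a pair_pre_digraph \<Rightarrow> enat" where
  "patrol_number G = Inf {enat \<rho> | \<rho>. \<exists>c. winning_patrol G \<rho> c}"

definition weak_hom :: "'a pair_pre_digraph \<Rightarrow> 'b pair_pre_digraph \<Rightarrow> ('a \<Rightarrow> 'b) \<Rightarrow> bool" where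
  "weak_hom G H \<phi> \<longleftrightarrow>
    \<phi> ` pverts G \<subseteq> pverts H \<and>
    (\<forall>(u, v) \<in> parcs G. \<phi> u = \<phi> v \<or> (\<phi> u, \<phi> v) \<in> parcs H)"

definition weak_retract :: "'a pair_pre_digraph \<Rightarrow> 'a pair_pre_digraph \<Rightarrow> bool" where
  "weak_retract H G \<longleftrightarrow>
    subgraph (with_proj H) (with_proj G) \<and> (\<exists>\<phi>. weak_hom G H \<phi> \<and> (\<forall>u \<in> pverts H. \<phi> u = u))"

end

theory Submission
  imports Defs
begin

text \<open>
  A weak homomorphism does not increase distances.  Hence, if a patrol \<open>c\<close> wins on \<open>G\<close> with
  some radius and \<open>\<phi>\<close> is a retraction of \<open>G\<close> onto \<open>H\<close>, the projected patrol \<open>\<phi> \<circ> c\<close> wins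
  on \<open>H\<close> with the same radius: a play on \<open>H\<close> is a play on \<open>G\<close> fixed by \<open>\<phi>\<close>, so its capture
  by \<open>c\<close> in \<open>G\<close> projects to a capture by \<open>\<phi> \<circ> c\<close> in \<open>H\<close>.
\<close>

text \<open>Map the walk arc by arc and drop the arcs whose ends \<open>\<phi>\<close> identifies;
  such arcs would be loops in the image. This is why the length may shrink.\<close>

lemma weak_hom_awalk:
  assumes G: "wf_digraph (with_proj G)" and H: "wf_digraph (with_proj H)"
    and hom: "weak_hom G H \<phi>"
    and walk: "pre_digraph.awalk (with_proj G) u p v"
  obtains q where "pre_digraph.awalk (with_proj H) (\<phi> u) q (\<phi> v)" "length q \<le> length p"
proof -
  interpret G: wf_digraph "with_proj G" by (fact G)
  interpret H: wf_digraph "with_proj H" by (fact H)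
  have "\<exists>q. H.awalk (\<phi> u) q (\<phi> v) \<and> length q \<le> length p"
    using walk
  proof (induction p arbitrary: u)
    case Nil
    then have "H.awalk (\<phi> u) [] (\<phi> v)"
      using hom by (auto simp: G.awalk_Nil_iff H.awalk_Nil_iff weak_hom_def)
    then show ?case by force
  next
    case (Cons e p)
    then obtain w where e: "(u, w) \<in> parcs G" and "G.awalk w p v"
      by (cases e) (auto simp: G.awalk_Cons_iff)
    then obtain q where q: "H.awalk (\<phi> w) q (\<phi> v)" "length q \<le> length p"
      using Cons.IH by blast
    from e hom consider "\<phi> u = \<phi> w" | "(\<phi> u, \<phi> w) \<in> parcs H"
      by (auto simp: weak_hom_def)
    then show ?case
    proof cases
      case 1
      with q show ?thesis by (auto intro: le_SucI)
    next
      case 2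
      with q have "H.awalk (\<phi> u) ((\<phi> u, \<phi> w) # q) (\<phi> v)"
        by (simp add: H.awalk_Cons_iff)
      with q(2) show ?thesis by force
    qed
  qed
  then show thesis using that by blast
qed

lemma weak_hom_graph_dist_le:
  assumes G: "wf_digraph (with_proj G)" and H: "wf_digraph (with_proj H)"
    and hom: "weak_hom G H \<phi>"
  shows "graph_dist H (\<phi> u) (\<phi> v) \<le> graph_dist G u v"
proof -
  interpret G: wf_digraph "with_proj G" by (fact G)
  interpret H: wf_digraph "with_proj H" by (fact H)
  show ?thesis
    unfolding graph_dist_def G.\<mu>_def H.\<mu>_def
  \<comment> \<open>Each walk in \<open>G\<close> is matched by one in \<open>H\<close> of no larger
    cost, the cost with unit weights being the length. If no walk joins \<open>u\<close> to
    \<open>v\<close>, the infimum on the right is infinite.\<close>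
  proof (rule INF_mono)
    fix p assume "p \<in> {p. G.awalk u p v}"
    then obtain q where "H.awalk (\<phi> u) q (\<phi> v)" "length q \<le> length p"
      using weak_hom_awalk[OF G H hom] by blast
    then show "\<exists>q\<in>{q. H.awalk (\<phi> u) q (\<phi> v)}.
        ereal (H.awalk_cost (\<lambda>_. 1) q) \<le> ereal (G.awalk_cost (\<lambda>_. 1) p)"
      by (auto simp: G.awalk_cost_def H.awalk_cost_def sum_list_triv)
  qed
qed

text \<open>Staying put is a legal move, so an edge collapsed by \<open>\<phi>\<close> still gives a
  legal step.\<close>

lemma weak_hom_lazy_walk:
  assumes "weak_hom G H \<phi>" "lazy_walk G w"
  shows "lazy_walk H (\<phi> \<circ> w)"
proof -
  have "\<phi> (w (Suc i)) = \<phi> (w i) \<or> (\<phi> (w i), \<phi> (w (Suc i))) \<in> parcs H" for i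
    using assms unfolding weak_hom_def lazy_walk_def by (metis (mono_tags, lifting) case_prodD)
  with assms show ?thesis
    by (auto simp: weak_hom_def lazy_walk_def)
qed

lemma subgraph_lazy_walk:
  assumes "subgraph (with_proj H) (with_proj G)" "lazy_walk H w"
  shows "lazy_walk G w"
  using assms by (auto simp: subgraph_def lazy_walk_def)

lemma retraction_winning_patrol:
  assumes sub: "subgraph (with_proj H) (with_proj G)"
    and hom: "weak_hom G H \<phi>" and fixes_H: "\<forall>u \<in> pverts H. \<phi> u = u"
    and win: "winning_patrol G \<rho> c"
  shows "winning_patrol H \<rho> (\<phi> \<circ> c)"
  unfolding winning_patrol_def
proof (intro conjI allI impI)
  show "lazy_walk H (\<phi> \<circ> c)"
    using hom win by (auto simp: winning_patrol_def intro: weak_hom_lazy_walk)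
next
  fix r assume r: "lazy_walk H r"
  have wf: "wf_digraph (with_proj G)" "wf_digraph (with_proj H)"
    using sub by (auto simp: subgraph_def)
  have "\<phi> (r i) = r i" for i
    using r fixes_H by (simp add: lazy_walk_def)
  \<comment> \<open>Keeping \<open>u\<close> arbitrary serves both capture tests, at
    \<open>c i\<close> and at \<open>c (Suc i)\<close>.\<close>
  then have "graph_dist H (\<phi> u) (r i) \<le> graph_dist G u (r i)" for u i
    using weak_hom_graph_dist_le[OF wf hom, of u "r i"] by simp
  moreover have "captures G \<rho> c r"
    using win subgraph_lazy_walk[OF sub r] by (simp add: winning_patrol_def)
  ultimately show "captures H \<rho> (\<phi> \<circ> c) r"
    unfolding captures_def comp_def by (meson order_trans)
qed

lemma weak_retract_patrol_number_le:
  assumes "weak_retract H G"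
  shows "patrol_number H \<le> patrol_number G"
  unfolding patrol_number_def
  \<comment> \<open>Every radius that wins on \<open>G\<close> wins on \<open>H\<close>, so the
    infimum for \<open>H\<close> runs over a larger set; if no radius wins on \<open>G\<close>, the
    right side is \<infinity>.\<close>
  using assms by (intro Inf_superset_mono) (auto simp: weak_retract_def intro: retraction_winning_patrol)

theorem theorem1:
  fixes G H :: "'a pair_pre_digraph" and \<rho> :: nat
  assumes "pair_bidirected_digraph G"
    and "Digraph_Component.connected (with_proj G)"
    and "pair_bidirected_digraph H"
    and "subgraph (with_proj H) (with_proj G)"
    and "weak_retract H G"
    and "patrol_number H > enat \<rho>"
  shows "patrol_number G > enat \<rho>"
  using assms(6) weak_retract_patrol_number_le[OF assms(5)] by (rule less_le_trans)

end
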